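(* Let $\varphi\colon S\to T$ be a homomorphism of inverse semigroups such that $\varphi|_{E(S)}\colon E(S)\to E(T)$ is locally coherent. Then there is a continuous homomorphism (continuous functor) $\Phi\colon\mathscr G(S)\to\mathscr G(T)$ of universal groupoids given by $[s,F]\mapsto[\varphi(s),\widehat\varphi(F)]$, where $F$ is a filter on $E(S)$ with $s^*s\in F$.
   Context: An inverse semigroup is a semigroup $S$ in which each $s$ has a unique $s^*$ with $s=ss^*s$, $s^*=s^*ss^*$; $E(S)$ is its semilattice of idempotents; $s\le t$ iff $s=te$ for some $e\in E(S)$. A filter on a semilattice $E$ is a non-empty upward closed subset closed under products (the whole of $E$ is allowed). $\widehat E$ is the space of all filters on $E$, with the topology from $\{0,1\}^E$ via characteristic functions (equivalently, the space of non-zero semilattice homomorphisms $E\to\{0,1\}$); $D(e)=\{F\in\widehat E\mid e\in F\}$. For a semilattice homomorphism $\varphi\colon E_1\to E_2$ and a filter $F$ on $E_1$, $\widehat\varphi(F)=\varphi(F)^{\uparrow}=\{x\in E_2\mid x\ge\varphi(f)\text{ for some }f\in F\}$, a filter on $E_2$; for an inverse semigroup homomorphism $\varphi$, $\widehat\varphi$ means this for $\varphi|_{E(S)}$. The universal groupoid $\mathscr G(S)$: with $E=E(S)$, for $F\in D(s^*s)$ put $sF=\{e\in E\mid s^*es\in F\}\in D(ss^* )$. Arrows are classes $[s,F]$ with $s\in S$, $F\in D(s^*s)$, where $(s,F)\sim(t,F')$ iff $F=F'$ and there is $u\le s,t$ with $u^*u\in F$; $d[s,F]=F$, $r[s,F]=sF$,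 $[s',sF][s,F]=[s's,F]$, $[s,F]^{-1}=[s^*,sF]$; basis of the topology: $(s,U)=\{[s,F]\mid F\in U\}$, $U\subseteq D(s^*s)$ open in $\widehat E$. Posets carry the Alexandrov topology, whose open sets are the downsets ($y\le x\in Y\Rightarrow y\in Y$). A downset is finitely generated if it consists of the elements below some member of a finite (possibly empty) subset of it; these are exactly the quasi-compact open sets. A map $f\colon P\to Q$ of posets is coherent if the preimage of each finitely generated downset is a finitely generated downset, and locally coherent if each $x\in P$ has a neighborhood $U$ such that $f|_U\colon U\to Q$ is coherent. *)

theory Defs
  imports "HOL-Analysis.Analysis"
begin

class inverse_semigroup = semigroup_mult +
  assumes ex1_inverse: "\<exists>!t. s = s * t * s \<and> t = t * s * t"

definition star :: "'a::inverse_semigroup \<Rightarrow> 'a" where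
  "star s = (THE t. s = s * t * s \<and> t = t * s * t)"

definition idempotents :: "'a::inverse_semigroup set" where
  "idempotents = {e. e * e = e}"

definition nat_le :: "'a::inverse_semigroup \<Rightarrow> 'a \<Rightarrow> bool" where
  "nat_le s t \<longleftrightarrow> (\<exists>e\<in>idempotents. s = t * e)"

definition semigroup_hom :: "('a::inverse_semigroup \<Rightarrow> 'b::inverse_semigroup) \<Rightarrow> bool" where
  "semigroup_hom \<phi> \<longleftrightarrow> (\<forall>x y. \<phi> (x * y) = \<phi> x * \<phi> y)"

text \<open>A poset is given by a carrier set \<open>P\<close> and a relation \<open>le\<close> on the ambient type; a subset
  \<open>U\<close> of \<open>P\<close> is then a poset with the same relation.\<close>

definition downset :: "'a set \<Rightarrow> ('a \<Rightarrow> 'a \<Rightarrow> bool) \<Rightarrow> 'a set \<Rightarrow> bool" where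
  "downset P le Y \<longleftrightarrow> Y \<subseteq> P \<and> (\<forall>x\<in>Y. \<forall>y\<in>P. le y x \<longrightarrow> y \<in> Y)"

definition alexandrov_topology :: "'a set \<Rightarrow> ('a \<Rightarrow> 'a \<Rightarrow> bool) \<Rightarrow> 'a topology" where
  "alexandrov_topology P le = topology (downset P le)"

lemma openin_alexandrov_topology: "openin (alexandrov_topology P le) Y \<longleftrightarrow> downset P le Y"
proof -
  have "istopology (downset P le)"
    unfolding istopology_def downset_def by blast
  then show ?thesis
    by (simp add: alexandrov_topology_def)
qed

definition fin_gen_downset :: "'a set \<Rightarrow> ('a \<Rightarrow> 'a \<Rightarrow> bool) \<Rightarrow> 'a set \<Rightarrow> bool" where
  "fin_gen_downset P le Y \<longleftrightarrow>
     downset P le Y \<and> (\<exists>G. finite G \<and> G \<subseteq> Y \<and> Y = {y \<in> P. \<exists>g\<in>G. le y g})"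

definition coherent ::
  "'a set \<Rightarrow> ('a \<Rightarrow> 'a \<Rightarrow> bool) \<Rightarrow> 'b set \<Rightarrow> ('b \<Rightarrow> 'b \<Rightarrow> bool) \<Rightarrow> ('a \<Rightarrow> 'b) \<Rightarrow> bool" where
  "coherent P le Q le' f \<longleftrightarrow>
     f \<in> P \<rightarrow> Q \<and> (\<forall>Y. fin_gen_downset Q le' Y \<longrightarrow> fin_gen_downset P le {x \<in> P. f x \<in> Y})"

text \<open>Neighborhoods are not required to be open.\<close>

definition locally_coherent ::
  "'a set \<Rightarrow> ('a \<Rightarrow> 'a \<Rightarrow> bool) \<Rightarrow> 'b set \<Rightarrow> ('b \<Rightarrow> 'b \<Rightarrow> bool) \<Rightarrow> ('a \<Rightarrow> 'b) \<Rightarrow> bool" where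
  "locally_coherent P le Q le' f \<longleftrightarrow>
     f \<in> P \<rightarrow> Q \<and>
     (\<forall>x\<in>P. \<exists>U. U \<subseteq> P \<and> (\<exists>V. openin (alexandrov_topology P le) V \<and> x \<in> V \<and> V \<subseteq> U) \<and>
              coherent U le Q le' f)"

definition filters :: "'a::inverse_semigroup set set" where
  "filters = {F. F \<subseteq> idempotents \<and> F \<noteq> {} \<and>
     (\<forall>x\<in>F. \<forall>y\<in>idempotents. nat_le x y \<longrightarrow> y \<in> F) \<and> (\<forall>x\<in>F. \<forall>y\<in>F. x * y \<in> F)}"

text \<open>Filters are topologized through their characteristic functions, as a subspace of
  \<open>{0,1}\<close> to the power \<open>E(S)\<close>.\<close>

definition filter_space :: "'a::inverse_semigroup set topology" where
  "filter_space =
     pullback_topology filters (\<lambda>F. restrict (\<lambda>e. e \<in> F) idempotents)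
       (product_topology (\<lambda>_. discrete_topology (UNIV :: bool set)) idempotents)"

definition basic_open :: "'a::inverse_semigroup \<Rightarrow> 'a set set" where
  "basic_open e = {F \<in> filters. e \<in> F}"

definition filter_map ::
  "('a::inverse_semigroup \<Rightarrow> 'b::inverse_semigroup) \<Rightarrow> 'a set \<Rightarrow> 'b set" where
  "filter_map \<phi> F = {x \<in> idempotents. \<exists>f\<in>F. nat_le (\<phi> f) x}"

text \<open>The objects and the arrows are the points of \<open>obj_space\<close> and \<open>arr_space\<close>;
  \<open>gcomp G a b\<close> is the product \<open>ab\<close> (first \<open>b\<close>, then \<open>a\<close>), meaningful
  when \<open>src G a = tgt G b\<close>.\<close>

record ('o, 'm) groupoid_data =
  obj_space :: "'o topology"
  arr_space :: "'m topology"
  src :: "'m \<Rightarrow> 'o"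
  tgt :: "'m \<Rightarrow> 'o"
  unit_arr :: "'o \<Rightarrow> 'm"
  gcomp :: "'m \<Rightarrow> 'm \<Rightarrow> 'm"
  ginv :: "'m \<Rightarrow> 'm"

definition continuous_functor ::
  "('o, 'm) groupoid_data \<Rightarrow> ('p, 'n) groupoid_data \<Rightarrow> ('o \<Rightarrow> 'p) \<Rightarrow> ('m \<Rightarrow> 'n) \<Rightarrow> bool" where
  "continuous_functor G H \<Phi>\<^sub>0 \<Phi> \<longleftrightarrow>
     continuous_map (obj_space G) (obj_space H) \<Phi>\<^sub>0 \<and>
     continuous_map (arr_space G) (arr_space H) \<Phi> \<and>
     (\<forall>a \<in> topspace (arr_space G).
        src H (\<Phi> a) = \<Phi>\<^sub>0 (src G a) \<and> tgt H (\<Phi> a) = \<Phi>\<^sub>0 (tgt G a)) \<and>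
     (\<forall>x \<in> topspace (obj_space G). \<Phi> (unit_arr G x) = unit_arr H (\<Phi>\<^sub>0 x)) \<and>
     (\<forall>a \<in> topspace (arr_space G). \<forall>b \<in> topspace (arr_space G).
        src G a = tgt G b \<longrightarrow> \<Phi> (gcomp G a b) = gcomp H (\<Phi> a) (\<Phi> b)) \<and>
     (\<forall>a \<in> topspace (arr_space G). \<Phi> (ginv G a) = ginv H (\<Phi> a))"

definition act :: "'a::inverse_semigroup \<Rightarrow> 'a set \<Rightarrow> 'a set" where
  "act s F = {e \<in> idempotents. star s * e * s \<in> F}"

definition germ_rel :: "(('a::inverse_semigroup \<times> 'a set) \<times> ('a \<times> 'a set)) set" where
  "germ_rel = {((s, F), (t, F')). F \<in> basic_open (star s * s) \<and> F' \<in> basic_open (star t * t) \<and>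
     F = F' \<and> (\<exists>u. nat_le u s \<and> nat_le u t \<and> star u * u \<in> F)}"

definition germ :: "'a::inverse_semigroup \<Rightarrow> 'a set \<Rightarrow> ('a \<times> 'a set) set" where
  "germ s F = germ_rel `` {(s, F)}"

definition germ_space :: "('a::inverse_semigroup \<times> 'a set) set topology" where
  "germ_space = topology_generated_by
     {{germ s F | F. F \<in> U} | s U. openin filter_space U \<and> U \<subseteq> basic_open (star s * s)}"

text \<open>Operations on classes take the union of the classes obtained from all choices of
  representatives; as the operations are well defined, all these classes coincide. The unit at
  \<open>F\<close> is the class of \<open>(e, F)\<close> for any \<open>e \<in> F\<close>.\<close>

definition universal_groupoid ::
  "'a::inverse_semigroup itself \<Rightarrow> ('a set, ('a \<times> 'a set) set) groupoid_data" where
  "universal_groupoid _ = \<lparr>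
     obj_space = filter_space,
     arr_space = germ_space,
     src = (\<lambda>a. THE F. \<exists>s. (s, F) \<in> a),
     tgt = (\<lambda>a. THE F'. \<exists>s F. (s, F) \<in> a \<and> F' = act s F),
     unit_arr = (\<lambda>F. \<Union>e\<in>F. germ e F),
     gcomp = (\<lambda>a b. \<Union>{germ (t * s) F | t s F. (t, act s F) \<in> a \<and> (s, F) \<in> b}),
     ginv = (\<lambda>a. \<Union>{germ (star s) (act s F) | s F. (s, F) \<in> a}) \<rparr>"

end

theory Submission
  imports Defs
begin

text \<open>Local coherence is needed only for the continuity of \<open>filter_map \<phi>\<close>. For \<open>f\<close> in \<open>E(S)\<close>, it
  supplies a set \<open>U\<close> containing everything below \<open>f\<close> such that \<open>{x \<in> U. \<phi> x \<le> y}\<close> has finitely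
  many generators \<open>g\<^sub>1, \<dots>, g\<^sub>n\<close>. A filter \<open>F\<close> containing \<open>f\<close> then satisfies \<open>y \<in> filter_map \<phi> F\<close>
  iff it contains one of the \<open>g\<^sub>i\<close>, and this is a clopen condition. Continuity on arrows follows because
  an equality of germs is witnessed by a single \<open>u\<close>, and \<open>star u * u \<in> filter_map \<phi> F\<close> is open in \<open>F\<close>.\<close>

section \<open>Inverse semigroups\<close>

lemma star_spec: "s = s * star s * s \<and> star s = star s * s * star s"
  unfolding star_def by (rule theI'[OF ex1_inverse])

lemma star_unique:
  assumes "s * t * s = s" "t * s * t = t"
  shows "star s = t"
  using assms star_spec ex1_inverse by metis

lemma mult_star_mult [simp]: "s * (star s * s) = s"
  by (metis star_spec mult.assoc)

text \<open>The trailing factor \<open>x\<close> lets the cancellation fire inside right-nested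
  products. The other \<open>_left\<close> lemmas serve the same purpose.\<close>

lemma mult_star_mult_left [simp]: "s * (star s * (s * x)) = s * x"
  by (metis mult_star_mult mult.assoc)

lemma star_mult_star [simp]: "star s * (s * star s) = star s"
  by (metis star_spec mult.assoc)

lemma star_mult_star_left [simp]: "star s * (s * (star s * x)) = star s * x"
  by (metis star_mult_star mult.assoc)

lemma star_star [simp]: "star (star s) = s"
  by (rule star_unique) (simp_all add: mult.assoc)

lemma idem_mult: "e \<in> idempotents \<Longrightarrow> e * e = e"
  by (simp add: idempotents_def)

lemma idem_mult_left: "e \<in> idempotents \<Longrightarrow> e * (e * x) = e * x"
  by (metis idem_mult mult.assoc)

lemma star_idem: "e \<in> idempotents \<Longrightarrow> star e = e"
  by (rule star_unique) (simp_all add: idem_mult)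

text \<open>Let \<open>x\<close> be the inverse of \<open>e * f\<close>. Then
  \<open>f * x * e\<close> is an inverse of \<open>e * f\<close> as well, so it equals
  \<open>x\<close> by uniqueness, and this form makes \<open>x\<close> idempotent. Idempotents are
  their own inverses, so \<open>e * f = star x = x\<close>.\<close>

lemma mult_idem [intro]:
  assumes e: "e \<in> idempotents" and f: "f \<in> idempotents"
  shows "e * f \<in> idempotents"
proof -
  note i = idem_mult[OF e] idem_mult[OF f] idem_mult_left[OF e] idem_mult_left[OF f]
  define x where "x = star (e * f)"
  have 1: "e * (f * (x * (e * f))) = e * f" and 2: "x * (e * (f * x)) = x"
    unfolding x_def by (metis mult_star_mult mult.assoc, metis star_mult_star mult.assoc)
  have 3: "x * (e * (f * (x * y))) = x * y" for y
    using 2 by (metis mult.assoc)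
  have x: "x = f * (x * e)"
    by (subst x_def, rule star_unique) (simp_all add: mult.assoc i 1 3)
  have "x * x = f * (x * e) * (f * (x * e))"
    using x by simp
  also have "\<dots> = x"
    by (simp add: mult.assoc 3) (simp flip: x)
  finally have "x \<in> idempotents"
    by (simp add: idempotents_def)
  moreover have "star x = e * f"
    by (simp add: x_def)
  ultimately show ?thesis
    using star_idem by metis
qed

text \<open>\<open>f * e\<close> is an inverse of \<open>e * f\<close>, which as an idempotent is
  already its own inverse.\<close>

lemma idem_commute:
  assumes e: "e \<in> idempotents" and f: "f \<in> idempotents"
  shows "e * f = f * e"
proof -
  note i = idem_mult[OF e] idem_mult[OF f] idem_mult_left[OF e] idem_mult_left[OF f]
    idem_mult[OF mult_idem[OF e f], unfolded mult.assoc]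
    idem_mult[OF mult_idem[OF f e], unfolded mult.assoc]
  have "star (e * f) = f * e"
    by (rule star_unique) (simp_all add: mult.assoc i)
  then show ?thesis
    using star_idem[OF mult_idem[OF e f]] by simp
qed

lemma idem_left_commute:
  "e \<in> idempotents \<Longrightarrow> f \<in> idempotents \<Longrightarrow> e * (f * x) = f * (e * x)"
  by (metis idem_commute mult.assoc)

lemma star_mult_self_idem [simp, intro]: "star s * s \<in> idempotents"
  by (simp add: idempotents_def mult.assoc)

lemma mult_star_self_idem [simp, intro]: "s * star s \<in> idempotents"
  by (simp add: idempotents_def mult.assoc)

text \<open>Commutation of \<open>e\<close> with the idempotent \<open>s * star s\<close>, in a form
  that rewrites right-nested products by moving \<open>e\<close> to the left.\<close>

lemma mult_star_idem:
  "e \<in> idempotents \<Longrightarrow> s * (star s * (e * x)) = e * (s * (star s * x))"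
  using idem_left_commute[of "s * star s" e x] by (simp add: mult.assoc)

lemma conj_idem [simp, intro]:
  assumes "e \<in> idempotents"
  shows "star s * e * s \<in> idempotents"
  using assms by (simp add: idempotents_def mult.assoc mult_star_idem[OF assms] idem_mult_left[OF assms])

text \<open>Each of the two inverse equations reduces to swapping the idempotents
  \<open>t * star t\<close> and \<open>star s * s\<close>, after which both factors cancel.\<close>

lemma star_mult: "star (s * t) = star t * star s"
proof (rule star_unique)
  have "s * ((t * star t) * ((star s * s) * t)) = s * ((star s * s) * ((t * star t) * t))"
    by (subst idem_left_commute) auto
  then show "s * t * (star t * star s) * (s * t) = s * t"
    by (simp add: mult.assoc)
  have "star t * ((star s * s) * ((t * star t) * star s)) =
      star t * ((t * star t) * ((star s * s) * star s))"
    by (subst idem_left_commute) auto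
  then show "star t * star s * (s * t) * (star t * star s) = star t * star s"
    by (simp add: mult.assoc)
qed

section \<open>The natural partial order\<close>

lemma nat_le_mult_idem: "e \<in> idempotents \<Longrightarrow> nat_le (t * e) t"
  unfolding nat_le_def by blast

text \<open>The order allows an idempotent factor on the right. One on the left crosses over by
  conjugation: \<open>e * t = t * (star t * e * t)\<close>.\<close>

lemma nat_le_idem_mult: "e \<in> idempotents \<Longrightarrow> nat_le (e * t) t"
  unfolding nat_le_def
  by (rule bexI[of _ "star t * e * t"]) (simp add: mult.assoc mult_star_idem, rule conj_idem)

lemma nat_le_refl [simp, intro]: "nat_le s s"
  unfolding nat_le_def by (rule bexI[of _ "star s * s"]) simp_all

lemma nat_le_trans: "nat_le r s \<Longrightarrow> nat_le s t \<Longrightarrow> nat_le r t"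
  unfolding nat_le_def by (metis mult.assoc mult_idem)

lemma nat_le_mult:
  assumes "nat_le s t" "nat_le u v"
  shows "nat_le (s * u) (t * v)"
proof -
  obtain e f where e: "e \<in> idempotents" "s = t * e" and f: "f \<in> idempotents" "u = v * f"
    using assms unfolding nat_le_def by blast
  \<comment> \<open>Conjugation by \<open>v\<close> moves \<open>e\<close> past \<open>v\<close>, so
    that all idempotents collect on the right.\<close>
  have "s * u = t * v * ((star v * e * v) * f)"
    by (simp add: e f mult.assoc mult_star_idem)
  then show ?thesis
    using e f unfolding nat_le_def by blast
qed

lemma nat_le_star: "nat_le s t \<Longrightarrow> nat_le (star s) (star t)"
  unfolding nat_le_def[of s t] by (auto simp: star_mult star_idem intro: nat_le_idem_mult)

text \<open>If \<open>u = s * e\<close>, then \<open>star u * u = star s * s * e\<close>. Hence the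
  domain idempotent of \<open>u\<close> can replace the arbitrary \<open>e\<close>: an element below
  \<open>s\<close> is determined by its domain.\<close>

lemma nat_le_domain:
  assumes "nat_le u s"
  shows "u = s * (star u * u)"
proof -
  obtain e where e: "e \<in> idempotents" "u = s * e"
    using assms unfolding nat_le_def by blast
  have "star u * u = e * (star s * s) * e"
    by (simp add: e star_mult star_idem mult.assoc)
  also have "\<dots> = star s * s * e"
    using e(1) by (simp add: idem_commute[of e "star s * s"] mult.assoc idem_mult)
  finally show ?thesis
    by (simp add: e(2) mult.assoc)
qed

lemma nat_le_star_mult_self: "nat_le u s \<Longrightarrow> nat_le (star u * u) (star s * s)"
  by (intro nat_le_mult nat_le_star)

section \<open>Filters and germs\<close>

lemma filter_idem: "F \<in> filters \<Longrightarrow> e \<in> F \<Longrightarrow> e \<in> idempotents"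
  unfolding filters_def by blast

lemma filter_nonempty: "F \<in> filters \<Longrightarrow> \<exists>e. e \<in> F"
  unfolding filters_def by blast

lemma filter_up: "F \<in> filters \<Longrightarrow> e \<in> F \<Longrightarrow> nat_le e f \<Longrightarrow> f \<in> idempotents \<Longrightarrow> f \<in> F"
  unfolding filters_def by blast

lemma filter_mult: "F \<in> filters \<Longrightarrow> e \<in> F \<Longrightarrow> f \<in> F \<Longrightarrow> e * f \<in> F"
  unfolding filters_def by blast

lemma filter_mult_iff:
  assumes "F \<in> filters" "e \<in> idempotents" "f \<in> idempotents"
  shows "e * f \<in> F \<longleftrightarrow> e \<in> F \<and> f \<in> F"
  using assms filter_up filter_mult nat_le_mult_idem nat_le_idem_mult by metis

lemma act_filter:
  assumes F: "F \<in> filters" "star s * s \<in> F"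
  shows "act s F \<in> filters"
proof -
  \<comment> \<open>Witness of non-emptiness: its conjugate by \<open>s\<close> is
    \<open>star s * s\<close>, which lies in \<open>F\<close>.\<close>
  have "s * star s \<in> act s F"
    using F by (simp add: act_def mult.assoc)
  moreover have "y \<in> act s F" if "x \<in> act s F" "y \<in> idempotents" "nat_le x y" for x y
  proof -
    have "nat_le (star s * x * s) (star s * y * s)"
      using that by (intro nat_le_mult nat_le_refl)
    then show ?thesis
      using that F filter_up[of F "star s * x * s" "star s * y * s"] by (auto simp: act_def)
  qed
  moreover have "x * y \<in> act s F" if "x \<in> act s F" "y \<in> act s F" for x y
  proof -
    have "star s * (x * y) * s = star s * x * s * (star s * y * s)"
      using that by (simp add: act_def mult.assoc mult_star_idem)
    then show ?thesis
      using that F filter_mult[of F "star s * x * s" "star s * y * s"] by (auto simp: act_def)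
  qed
  ultimately show ?thesis
    unfolding filters_def using act_def[of s F] by blast
qed

text \<open>Restricting \<open>s\<close> to \<open>u = s * f\<close> turns the conjugate
  \<open>star s * e * s\<close> into \<open>f * (star s * e * s) * f\<close>. Since \<open>f\<close>
  is in \<open>F\<close>, this does not affect membership in \<open>F\<close>.\<close>

lemma act_nat_le:
  assumes F: "F \<in> filters" and u: "nat_le u s" "star u * u \<in> F"
  shows "act u F = act s F"
proof -
  define f where "f = star u * u"
  have f: "f \<in> idempotents" "f \<in> F" "u = s * f" "star u = f * star s"
    using u nat_le_domain[of u s] star_mult[of s f] star_idem[of f] by (auto simp: f_def)
  have "star u * e * u \<in> F \<longleftrightarrow> star s * e * s \<in> F" if e: "e \<in> idempotents" for e
  proof -
    have "star u * e * u = f * (star s * e * s) * f"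
      by (simp only: f(4)) (simp only: f(3) mult.assoc)
    then show ?thesis
      using F f conj_idem[OF e] filter_mult_iff by (metis mult_idem)
  qed
  then show ?thesis
    by (auto simp: act_def)
qed

section \<open>Germs as equivalence classes\<close>

lemma germ_relD:
  assumes "((s, F), (t, F')) \<in> germ_rel"
  shows "F' = F" "F \<in> filters" "star s * s \<in> F" "star t * t \<in> F"
    "\<exists>u. nat_le u s \<and> nat_le u t \<and> star u * u \<in> F"
  using assms by (auto simp: germ_rel_def basic_open_def)

text \<open>The domain conditions on \<open>s\<close> and \<open>t\<close> come for free: both
  domain idempotents lie above \<open>star u * u\<close>, and \<open>F\<close> is upward
  closed.\<close>

lemma germ_relI:
  assumes "F \<in> filters" "nat_le u s" "nat_le u t" "star u * u \<in> F"
  shows "((s, F), (t, F)) \<in> germ_rel"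
  using assms filter_up[OF assms(1,4)] nat_le_star_mult_self
  by (auto simp: germ_rel_def basic_open_def)

text \<open>This makes the target of a germ independent of the representative.\<close>

lemma germ_rel_act: "((s, F), (t, F')) \<in> germ_rel \<Longrightarrow> act t F = act s F"
  using germ_relD[of s F t F'] act_nat_le by metis

lemma equiv_germ_rel: "equiv {(s, F). F \<in> basic_open (star s * s)} germ_rel"
proof (rule equivI)
  show "germ_rel \<subseteq> {(s, F). F \<in> basic_open (star s * s)} \<times> {(s, F). F \<in> basic_open (star s * s)}"
    by (auto simp: germ_rel_def)
  show "refl_on {(s, F). F \<in> basic_open (star s * s)} germ_rel"
    by (auto simp: refl_on_def basic_open_def intro: germ_relI[OF _ nat_le_refl nat_le_refl])
  show "sym germ_rel"
    by (auto simp: sym_def germ_rel_def)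
  show "trans germ_rel"
  proof (rule transI, clarify)
    fix s F t F' r F''
    assume 1: "((s, F), (t, F')) \<in> germ_rel" and 2: "((t, F'), (r, F'')) \<in> germ_rel"
    have F: "F \<in> filters" "F' = F" "F'' = F"
      using germ_relD[OF 1] germ_relD[OF 2] by auto
    obtain u v where u: "nat_le u s" "nat_le u t" "star u * u \<in> F"
      and v: "nat_le v t" "nat_le v r" "star v * v \<in> F"
      using germ_relD(5)[OF 1] germ_relD(5)[OF 2] F by auto
    \<comment> \<open>Both \<open>u\<close> and \<open>v\<close> are restrictions of
      \<open>t\<close>. Restricting \<open>u\<close> to the domain of \<open>v\<close> therefore
      gives the same element as restricting \<open>v\<close> to the domain of \<open>u\<close>, a
      common lower bound of the two.\<close>
    define x where "x = u * (star v * v)"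
    have "x = t * (star u * u) * (star v * v)"
      using nat_le_domain[OF u(2)] by (simp add: x_def)
    also have "\<dots> = t * (star v * v) * (star u * u)"
      by (metis idem_commute mult.assoc star_mult_self_idem)
    also have "\<dots> = v * (star u * u)"
      using nat_le_domain[OF v(1)] by simp
    finally have "nat_le x v"
      by (simp add: nat_le_mult_idem)
    moreover have "nat_le x u"
      by (simp add: x_def nat_le_mult_idem)
    moreover have "star x * x = (star v * v) * (star u * u) * (star v * v)"
      by (simp add: x_def star_mult star_idem mult.assoc)
    then have "star x * x \<in> F"
      using F u v by (metis filter_mult)
    ultimately show "((s, F), (r, F'')) \<in> germ_rel"
      using u v F by (auto intro: germ_relI nat_le_trans)
  qed
qed

lemma germ_eq_iff:
  assumes "F \<in> basic_open (star s * s)" "F' \<in> basic_open (star t * t)"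
  shows "germ s F = germ t F' \<longleftrightarrow> ((s, F), (t, F')) \<in> germ_rel"
  unfolding germ_def by (rule eq_equiv_class_iff[OF equiv_germ_rel]) (use assms in auto)

lemma germ_eqI:
  assumes "F \<in> filters" "nat_le u s" "nat_le u t" "star u * u \<in> F"
  shows "germ s F = germ t F"
  using germ_relI[OF assms] unfolding germ_def by (rule equiv_class_eq[OF equiv_germ_rel])

lemma mem_germ_iff: "(t, F') \<in> germ s F \<longleftrightarrow> ((s, F), (t, F')) \<in> germ_rel"
  by (simp add: germ_def)

lemma mem_germ_self: "F \<in> filters \<Longrightarrow> star s * s \<in> F \<Longrightarrow> (s, F) \<in> germ s F"
  by (simp add: mem_germ_iff germ_relI[of F s])

section \<open>Structure of the universal groupoid\<close>

lemma src_germ: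
  assumes "F \<in> filters" "star s * s \<in> F"
  shows "src (universal_groupoid TYPE('a::inverse_semigroup)) (germ s F) = F"
proof -
  have "F' = F" if "\<exists>t. (t, F') \<in> germ s F" for F'
    using that germ_relD(1) unfolding mem_germ_iff by blast
  then show ?thesis
    unfolding universal_groupoid_def groupoid_data.simps
    using mem_germ_self[OF assms] by (intro the_equality) blast+
qed

lemma tgt_germ:
  assumes "F \<in> filters" "star s * s \<in> F"
  shows "tgt (universal_groupoid TYPE('a::inverse_semigroup)) (germ s F) = act s F"
proof -
  have "G = act s F" if "\<exists>t F'. (t, F') \<in> germ s F \<and> G = act t F'" for G
    using that germ_relD(1) germ_rel_act unfolding mem_germ_iff by metis
  then show ?thesis
    unfolding universal_groupoid_def groupoid_data.simps
    using mem_germ_self[OF assms] by (intro the_equality) blast+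
qed

lemma unit_germ:
  assumes F: "F \<in> filters" "e \<in> F"
  shows "unit_arr (universal_groupoid TYPE('a::inverse_semigroup)) F = germ e F"
proof -
  have "germ f F = germ e F" if f: "f \<in> F" for f
  \<comment> \<open>Two idempotents in \<open>F\<close> have the same germ at \<open>F\<close>,
    witnessed by their meet.\<close>
  proof (rule germ_eqI[of _ "e * f"])
    have ef: "e \<in> idempotents" "f \<in> idempotents"
      using F f filter_idem by auto
    show "nat_le (e * f) e" "nat_le (e * f) f"
      using ef by (auto intro: nat_le_mult_idem nat_le_idem_mult)
    show "star (e * f) * (e * f) \<in> F"
      using F f ef by (simp add: star_idem mult_idem idem_mult filter_mult)
  qed (use F in auto)
  then have "(\<Union>f\<in>F. germ f F) = germ e F"
    using F(2) by blast
  then show ?thesis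
    by (simp add: universal_groupoid_def)
qed

lemma gcomp_germ:
  assumes F: "F \<in> filters" "star s * s \<in> F" and t: "star t * t \<in> act s F"
  shows "gcomp (universal_groupoid TYPE('a::inverse_semigroup)) (germ t (act s F)) (germ s F)
    = germ (t * s) F"
proof -
  have "germ (t' * s') F' = germ (t * s) F"
    if t': "(t', act s' F') \<in> germ t (act s F)" and s': "(s', F') \<in> germ s F" for t' s' F'
  proof -
    note rt = t'[unfolded mem_germ_iff] and rs = s'[unfolded mem_germ_iff]
    obtain u v where u: "nat_le u t" "nat_le u t'" "star u * u \<in> act s F"
      and v: "nat_le v s" "nat_le v s'" "star v * v \<in> F"
      using germ_relD(5)[OF rt] germ_relD(5)[OF rs] by auto
    \<comment> \<open>The witness for the product is \<open>u * v\<close>. Its domain idempotent is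
      the conjugate \<open>star v * (star u * u) * v\<close>, so it lies in \<open>F\<close> exactly
      because \<open>star u * u\<close> lies in \<open>act v F\<close>.\<close>
    have "star u * u \<in> act v F"
      using u act_nat_le[OF F(1) v(1,3)] by simp
    then have "star (u * v) * (u * v) \<in> F"
      by (simp add: act_def star_mult mult.assoc)
    then show ?thesis
      using germ_eqI[OF F(1) nat_le_mult[OF u(2) v(2)] nat_le_mult[OF u(1) v(1)]] germ_relD(1)[OF rs]
      by simp
  qed
  moreover have "(t, act s F) \<in> germ t (act s F)" "(s, F) \<in> germ s F"
    using assms act_filter by (auto intro: mem_germ_self)
  \<comment> \<open>The classes from all choices of representatives form a singleton, so their union
    is that one class.\<close>
  ultimately have "{germ (t' * s') F' | t' s' F'.
      (t', act s' F') \<in> germ t (act s F) \<and> (s', F') \<in> germ s F} = {germ (t * s) F}"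
    by blast
  then show ?thesis
    by (simp add: universal_groupoid_def)
qed

lemma ginv_germ:
  assumes F: "F \<in> filters" "star s * s \<in> F"
  shows "ginv (universal_groupoid TYPE('a::inverse_semigroup)) (germ s F) = germ (star s) (act s F)"
proof -
  have "germ (star s') (act s' F') = germ (star s) (act s F)" if "(s', F') \<in> germ s F" for s' F'
  proof -
    note r = that[unfolded mem_germ_iff]
    obtain u where u: "nat_le u s" "nat_le u s'" "star u * u \<in> F"
      using germ_relD(5)[OF r] by auto
    \<comment> \<open>The witness for the inverses is \<open>star u\<close>, whose domain idempotent
      is \<open>u * star u\<close>.\<close>
    have "u * star u \<in> act u F"
      using u by (simp add: act_def mult.assoc)
    then have "star (star u) * star u \<in> act s F"
      using act_nat_le[OF F(1) u(1,3)] by simp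
    moreover have "act s' F' = act s F"
      using germ_rel_act[OF r] germ_relD(1)[OF r] by simp
    ultimately show ?thesis
      using germ_eqI[OF act_filter[OF F] nat_le_star[OF u(2)] nat_le_star[OF u(1)]] by simp
  qed
  then have "{germ (star s') (act s' F') | s' F'. (s', F') \<in> germ s F} = {germ (star s) (act s F)}"
    using mem_germ_self[OF F] by blast
  then show ?thesis
    by (simp add: universal_groupoid_def)
qed

section \<open>Topology of the universal groupoid\<close>

lemma topspace_filter_space [simp]: "topspace filter_space = filters"
  by (auto simp: filter_space_def topspace_pullback_topology)

text \<open>Membership of \<open>e\<close> is the characteristic function followed by projection to
  the coordinate \<open>e\<close>. Preimages of \<open>{True}\<close> and \<open>{False}\<close>
  then make \<open>basic_open e\<close> clopen.\<close>

lemma continuous_map_mem_filter: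
  assumes "e \<in> idempotents"
  shows "continuous_map filter_space (discrete_topology UNIV) (\<lambda>F. e \<in> F)"
proof -
  have "continuous_map filter_space (discrete_topology UNIV)
      ((\<lambda>x. x e) \<circ> (\<lambda>F. restrict (\<lambda>e. e \<in> F) idempotents))"
    unfolding filter_space_def
    by (intro continuous_map_pullback continuous_map_product_projection assms)
  then show ?thesis
    using assms by (simp add: o_def)
qed

lemma openin_basic_open:
  assumes "e \<in> idempotents"
  shows "openin filter_space (basic_open e)"
  using openin_continuous_map_preimage[OF continuous_map_mem_filter[OF assms], of "{True}"]
  by (simp add: basic_open_def)

lemma openin_not_basic_open:
  assumes "e \<in> idempotents"
  shows "openin filter_space (filters - basic_open e)"
  using openin_continuous_map_preimage[OF continuous_map_mem_filter[OF assms], of "{False}"]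
  by (simp add: basic_open_def set_diff_eq cong: conj_cong)

text \<open>Continuity into a power of the discrete space \<open>bool\<close> is checked
  coordinatewise, and there it means that the preimages of both truth values are open.\<close>

lemma continuous_map_into_filter_space:
  assumes "f \<in> topspace X \<rightarrow> filters"
    and pos: "\<And>e. e \<in> idempotents \<Longrightarrow> openin X {x \<in> topspace X. e \<in> f x}"
    and neg: "\<And>e. e \<in> idempotents \<Longrightarrow> openin X {x \<in> topspace X. e \<notin> f x}"
  shows "continuous_map X filter_space f"
  unfolding filter_space_def
proof (rule continuous_map_pullback')
  have "continuous_map X (discrete_topology UNIV) (\<lambda>x. e \<in> f x)" if e: "e \<in> idempotents" for e
  proof -
    have "openin X {x \<in> topspace X. (e \<in> f x) \<in> V}" for V
    proof -
      have "{x \<in> topspace X. (e \<in> f x) \<in> V} =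
          (if True \<in> V then {x \<in> topspace X. e \<in> f x} else {}) \<union>
          (if False \<in> V then {x \<in> topspace X. e \<notin> f x} else {})"
        by (auto split: if_splits) (metis (full_types))+
      then show ?thesis
        using pos[OF e] neg[OF e] by (auto intro: openin_Un)
    qed
    then show ?thesis
      by (auto simp: continuous_map_def)
  qed
  then show "continuous_map X (product_topology (\<lambda>_. discrete_topology UNIV) idempotents)
      ((\<lambda>F. restrict (\<lambda>e. e \<in> F) idempotents) \<circ> f)"
    by (auto simp: continuous_map_componentwise o_def)
  show "topspace X \<subseteq> f -` filters"
    using assms(1) by auto
qed

lemma topspace_germ_space:
  "topspace germ_space = {germ s F | s F. F \<in> filters \<and> star s * s \<in> F}"
  unfolding germ_space_def topology_generated_by_topspace
proof (intro equalityI subsetI)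
  fix a assume "a \<in> {germ s F | s F. F \<in> filters \<and> star s * s \<in> F}"
  then obtain s F where "a = germ s F" "F \<in> basic_open (star s * s)"
    by (auto simp: basic_open_def)
  \<comment> \<open>The full domain \<open>basic_open (star s * s)\<close> is itself an admissible
    \<open>U\<close>.\<close>
  then show "a \<in> \<Union> {{germ s F | F. F \<in> U} | s U. openin filter_space U \<and> U \<subseteq> basic_open (star s * s)}"
    using openin_basic_open[OF star_mult_self_idem, of s] by blast
qed (fastforce simp: basic_open_def)

lemma openin_germ_space:
  assumes "openin filter_space U" "U \<subseteq> basic_open (star s * s)"
  shows "openin germ_space {germ s F | F. F \<in> U}"
  unfolding germ_space_def by (rule topology_generated_by_Basis) (use assms in blast)

section \<open>The induced functor\<close>

lemma hom_mult: "semigroup_hom \<phi> \<Longrightarrow> \<phi> (x * y) = \<phi> x * \<phi> y"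
  by (simp add: semigroup_hom_def)

lemma hom_idem: "semigroup_hom \<phi> \<Longrightarrow> e \<in> idempotents \<Longrightarrow> \<phi> e \<in> idempotents"
  by (metis (mono_tags, lifting) idempotents_def hom_mult mem_Collect_eq)

text \<open>Preservation of products carries the two inverse equations over to
  \<open>\<phi> (star s)\<close>, and uniqueness of inverses does the rest.\<close>

lemma hom_star:
  assumes "semigroup_hom \<phi>"
  shows "\<phi> (star s) = star (\<phi> s)"
  by (rule star_unique[symmetric]) (simp_all add: hom_mult[OF assms, symmetric] mult.assoc)

lemma hom_nat_le: "semigroup_hom \<phi> \<Longrightarrow> nat_le s t \<Longrightarrow> nat_le (\<phi> s) (\<phi> t)"
  unfolding nat_le_def using hom_mult hom_idem by metis

lemma mem_filter_mapI:
  assumes "semigroup_hom \<phi>" "F \<in> filters" "e \<in> F"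
  shows "\<phi> e \<in> filter_map \<phi> F"
  using assms hom_idem filter_idem unfolding filter_map_def by (auto intro: bexI[of _ e])

lemma filter_map_filter:
  assumes h: "semigroup_hom \<phi>" and F: "F \<in> filters"
  shows "filter_map \<phi> F \<in> filters"
proof -
  have "filter_map \<phi> F \<noteq> {}"
    using mem_filter_mapI[OF h F] filter_nonempty[OF F] by auto
  moreover have "x * y \<in> filter_map \<phi> F" if xy: "x \<in> filter_map \<phi> F" "y \<in> filter_map \<phi> F" for x y
  proof -
    obtain e f where "e \<in> F" "nat_le (\<phi> e) x" "f \<in> F" "nat_le (\<phi> f) y"
      using xy unfolding filter_map_def by blast
    then have "e * f \<in> F" "nat_le (\<phi> (e * f)) (x * y)"
      using F by (auto simp: hom_mult[OF h] intro: nat_le_mult filter_mult)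
    then show ?thesis
      using that by (auto simp: filter_map_def)
  qed
  moreover have "filter_map \<phi> F \<subseteq> idempotents"
    by (auto simp: filter_map_def)
  moreover have "y \<in> filter_map \<phi> F"
    if "x \<in> filter_map \<phi> F" "y \<in> idempotents" "nat_le x y" for x y
    using that nat_le_trans unfolding filter_map_def by blast
  ultimately show ?thesis
    unfolding filters_def by blast
qed

lemma hom_domain_mem:
  assumes "semigroup_hom \<phi>" "F \<in> filters" "star s * s \<in> F"
  shows "star (\<phi> s) * \<phi> s \<in> filter_map \<phi> F"
  using mem_filter_mapI[OF assms] by (simp add: hom_mult[OF assms(1)] hom_star[OF assms(1)])

text \<open>Equivariance of the map on filters. It yields compatibility with targets and makes
  images of composable germs composable.\<close>

lemma filter_map_act:
  assumes h: "semigroup_hom \<phi>" and F: "F \<in> filters" "star s * s \<in> F"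
  shows "filter_map \<phi> (act s F) = act (\<phi> s) (filter_map \<phi> F)"
proof (intro equalityI subsetI)
  fix x assume "x \<in> filter_map \<phi> (act s F)"
  then obtain e where x: "x \<in> idempotents" "nat_le (\<phi> e) x" and e: "star s * e * s \<in> F"
    by (auto simp: filter_map_def act_def)
  have "nat_le (\<phi> (star s * e * s)) (star (\<phi> s) * x * \<phi> s)"
    unfolding hom_mult[OF h] hom_star[OF h] by (intro nat_le_mult nat_le_refl x)
  then show "x \<in> act (\<phi> s) (filter_map \<phi> F)"
    using x e by (auto simp: filter_map_def act_def)
next
  fix x assume "x \<in> act (\<phi> s) (filter_map \<phi> F)"
  then obtain f where x: "x \<in> idempotents" "nat_le (\<phi> f) (star (\<phi> s) * x * \<phi> s)" and f: "f \<in> F"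
    by (auto simp: filter_map_def act_def)
  have fi: "f \<in> idempotents"
    using F f filter_idem by blast
  \<comment> \<open>Conjugating \<open>f\<close> back along \<open>s\<close> gives the candidate.
    Conjugating it by \<open>s\<close> once more only multiplies \<open>f\<close> by
    \<open>star s * s\<close> on both sides, which stays in \<open>F\<close>.\<close>
  define e where "e = s * f * star s"
  have "e \<in> idempotents"
    using conj_idem[OF fi, of "star s"] by (simp add: e_def)
  moreover have "star s * e * s = (star s * s) * f * (star s * s)"
    by (simp add: e_def mult.assoc)
  then have "star s * e * s \<in> F"
    using F f by (metis filter_mult)
  moreover have "nat_le (\<phi> e) x"
  proof -
    \<comment> \<open>Conjugating the bound on \<open>\<phi> f\<close> in the same way leaves
      \<open>x\<close> times an idempotent, which is below \<open>x\<close>.\<close>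
    have "nat_le (\<phi> e) (\<phi> s * (star (\<phi> s) * x * \<phi> s) * star (\<phi> s))"
      using x(2) unfolding e_def hom_mult[OF h] hom_star[OF h] by (intro nat_le_mult nat_le_refl)
    also have "\<phi> s * (star (\<phi> s) * x * \<phi> s) * star (\<phi> s) = x * (\<phi> s * star (\<phi> s))"
      using x(1) by (simp add: mult.assoc mult_star_idem)
    finally show ?thesis
      by (rule nat_le_trans) (simp add: nat_le_mult_idem)
  qed
  ultimately show "x \<in> filter_map \<phi> (act s F)"
    using x by (auto simp: filter_map_def act_def)
qed

text \<open>If \<open>u\<close> witnesses the equality of two germs, \<open>\<phi> u\<close>
  witnesses the equality of their images.\<close>

lemma germ_hom_cong:
  assumes h: "semigroup_hom \<phi>" and r: "((s, F), (t, F')) \<in> germ_rel"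
  shows "germ (\<phi> t) (filter_map \<phi> F') = germ (\<phi> s) (filter_map \<phi> F)"
proof -
  obtain u where u: "nat_le u s" "nat_le u t" "star u * u \<in> F"
    using germ_relD(5)[OF r] by auto
  have F: "F \<in> filters" "F' = F"
    using germ_relD[OF r] by auto
  have "germ (\<phi> t) (filter_map \<phi> F) = germ (\<phi> s) (filter_map \<phi> F)"
    by (rule germ_eqI[of _ "\<phi> u"])
       (use u F h in \<open>auto intro: filter_map_filter hom_nat_le hom_domain_mem\<close>)
  then show ?thesis
    using F by simp
qed

text \<open>As for the groupoid operations, a union over all representatives avoids choosing one; by
  \<open>germ_hom_cong\<close> all the classes coincide.\<close>

definition germ_map ::
  "('a::inverse_semigroup \<Rightarrow> 'b::inverse_semigroup) \<Rightarrow> ('a \<times> 'a set) set \<Rightarrow> ('b \<times> 'b set) set" where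
  "germ_map \<phi> a = \<Union>{germ (\<phi> s) (filter_map \<phi> F) | s F. (s, F) \<in> a}"

lemma germ_map_germ:
  assumes h: "semigroup_hom \<phi>" and F: "F \<in> filters" "star s * s \<in> F"
  shows "germ_map \<phi> (germ s F) = germ (\<phi> s) (filter_map \<phi> F)"
proof -
  have "{germ (\<phi> t) (filter_map \<phi> F') | t F'. (t, F') \<in> germ s F} = {germ (\<phi> s) (filter_map \<phi> F)}"
    using germ_hom_cong[OF h, of s F] mem_germ_self[OF F] unfolding mem_germ_iff by blast
  then show ?thesis
    by (simp add: germ_map_def)
qed

section \<open>Continuity on filters\<close>

text \<open>\<open>G\<close> depends on \<open>f\<close> and \<open>y\<close> but not on
  \<open>F\<close>. Its finiteness makes the negated condition open among the filters containing
  \<open>f\<close>.\<close>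

lemma filter_map_locally_finite:
  assumes h: "semigroup_hom \<phi>"
    and lc: "locally_coherent idempotents nat_le idempotents nat_le \<phi>"
    and f: "f \<in> idempotents" and y: "y \<in> idempotents"
  shows "\<exists>G. finite G \<and> G \<subseteq> idempotents \<and>
    (\<forall>F\<in>filters. f \<in> F \<longrightarrow> (y \<in> filter_map \<phi> F \<longleftrightarrow> (\<exists>g\<in>G. g \<in> F)))"
proof -
  obtain U V where U: "U \<subseteq> idempotents" "downset idempotents nat_le V" "f \<in> V" "V \<subseteq> U"
    and coh: "coherent U nat_le idempotents nat_le \<phi>"
    using lc f unfolding locally_coherent_def openin_alexandrov_topology by metis
  \<comment> \<open>The principal downset of \<open>y\<close> is generated by \<open>{y}\<close>, so
    coherence on \<open>U\<close> applies to it.\<close>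
  have "fin_gen_downset idempotents nat_le {z \<in> idempotents. nat_le z y}"
    unfolding fin_gen_downset_def downset_def
  proof (intro conjI)
    show "\<exists>G. finite G \<and> G \<subseteq> {z \<in> idempotents. nat_le z y} \<and>
        {z \<in> idempotents. nat_le z y} = {z \<in> idempotents. \<exists>g\<in>G. nat_le z g}"
      using y by (intro exI[of _ "{y}"]) auto
  qed (use nat_le_trans in blast)+
  then have "fin_gen_downset U nat_le {x \<in> U. \<phi> x \<in> {z \<in> idempotents. nat_le z y}}"
    using coh unfolding coherent_def by blast
  then obtain G where G: "finite G" "G \<subseteq> {x \<in> U. \<phi> x \<in> {z \<in> idempotents. nat_le z y}}"
    and gen: "{x \<in> U. \<phi> x \<in> {z \<in> idempotents. nat_le z y}} = {x \<in> U. \<exists>g\<in>G. nat_le x g}"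
    unfolding fin_gen_downset_def by blast
  have "y \<in> filter_map \<phi> F \<longleftrightarrow> (\<exists>g\<in>G. g \<in> F)" if F: "F \<in> filters" "f \<in> F" for F
  proof
    assume "y \<in> filter_map \<phi> F"
    then obtain e where e: "e \<in> F" "nat_le (\<phi> e) y"
      by (auto simp: filter_map_def)
    have ei: "e \<in> idempotents"
      using F e filter_idem by blast
    \<comment> \<open>The witness \<open>e\<close> may lie outside \<open>U\<close>. Its meet with
      \<open>f\<close> is below \<open>f\<close>, hence in the downset \<open>V\<close>, and still
      belongs to \<open>F\<close>.\<close>
    have "e * f \<in> U"
      using U f ei nat_le_idem_mult[OF ei, of f] unfolding downset_def by blast
    moreover have "nat_le (\<phi> (e * f)) y"
      using e(2) nat_le_trans hom_nat_le[OF h nat_le_mult_idem[OF f]] by blast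
    ultimately have "e * f \<in> {x \<in> U. \<phi> x \<in> {z \<in> idempotents. nat_le z y}}"
      using ei f by (auto intro: hom_idem[OF h])
    then obtain g where "g \<in> G" "nat_le (e * f) g"
      using gen by blast
    moreover from this have "g \<in> idempotents"
      using G U by blast
    ultimately show "\<exists>g\<in>G. g \<in> F"
      using F e filter_mult filter_up by blast
  next
    \<comment> \<open>Generators belong to the preimage they generate, so \<open>\<phi> g\<close> is
      below \<open>y\<close>.\<close>
    assume "\<exists>g\<in>G. g \<in> F"
    then show "y \<in> filter_map \<phi> F"
      using G y by (auto simp: filter_map_def)
  qed
  moreover have "G \<subseteq> idempotents"
    using G U by blast
  ultimately show ?thesis
    using G by blast
qed

lemma continuous_map_filter_map:
  assumes h: "semigroup_hom \<phi>"
    and lc: "locally_coherent idempotents nat_le idempotents nat_le \<phi>"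
  shows "continuous_map filter_space filter_space (filter_map \<phi>)"
proof (rule continuous_map_into_filter_space)
  show "filter_map \<phi> \<in> topspace filter_space \<rightarrow> filters"
    using filter_map_filter[OF h] by auto
next
  fix y :: 'b assume y: "y \<in> idempotents"
  \<comment> \<open>By the definition of \<open>filter_map\<close>, this preimage is a union of
    basic open sets.\<close>
  have "{F \<in> topspace filter_space. y \<in> filter_map \<phi> F} =
      (\<Union>e\<in>{e \<in> idempotents. nat_le (\<phi> e) y}. basic_open e)"
    using y filter_idem unfolding filter_map_def basic_open_def topspace_filter_space by blast
  then show "openin filter_space {F \<in> topspace filter_space. y \<in> filter_map \<phi> F}"
    by (auto intro: openin_basic_open)
  show "openin filter_space {F \<in> topspace filter_space. y \<notin> filter_map \<phi> F}"
  proof (subst openin_subopen, clarify)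
    fix F assume F: "F \<in> topspace filter_space" "y \<notin> filter_map \<phi> F"
    then obtain f where f: "f \<in> F" "f \<in> idempotents"
      using filter_nonempty[of F] filter_idem[of F] by auto
    obtain G where G: "finite G" "G \<subseteq> idempotents"
      and iff: "\<forall>F\<in>filters. f \<in> F \<longrightarrow> (y \<in> filter_map \<phi> F \<longleftrightarrow> (\<exists>g\<in>G. g \<in> F))"
      using filter_map_locally_finite[OF h lc f(2) y] by (elim exE conjE)
    \<comment> \<open>Among filters containing \<open>f\<close>, omitting \<open>y\<close> from the
      image means omitting every \<open>g\<close> in \<open>G\<close>. The factor
      \<open>topspace filter_space\<close> covers empty \<open>G\<close>, where the intersection is
      the whole type.\<close>
    let ?W = "basic_open f \<inter> ((\<Inter>g\<in>G. filters - basic_open g) \<inter> topspace filter_space)"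
    have "openin filter_space ((\<Inter>g\<in>G. filters - basic_open g) \<inter> topspace filter_space)"
      by (rule openin_INT[OF G(1)]) (use G(2) openin_not_basic_open in blast)
    then have "openin filter_space ?W"
      by (rule openin_Int[OF openin_basic_open[OF f(2)]])
    moreover have "F \<in> ?W"
      using F f iff by (auto simp: basic_open_def)
    moreover have "?W \<subseteq> {F \<in> topspace filter_space. y \<notin> filter_map \<phi> F}"
      using iff by (auto simp: basic_open_def)
    ultimately show "\<exists>W. openin filter_space W \<and> F \<in> W \<and>
        W \<subseteq> {F \<in> topspace filter_space. y \<notin> filter_map \<phi> F}"
      by blast
  qed
qed

section \<open>Continuity on germs\<close>

lemma continuous_map_germ_map:
  assumes h: "semigroup_hom \<phi>" and c: "continuous_map filter_space filter_space (filter_map \<phi>)"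
  shows "continuous_map germ_space germ_space (germ_map \<phi>)"
proof -
  have 1: "openin germ_space (germ_map \<phi> -` {germ t F' | F'. F' \<in> V} \<inter> topspace germ_space)"
    if V: "openin filter_space V" "V \<subseteq> basic_open (star t * t)" for t V
  proof (subst openin_subopen, rule ballI)
    fix a assume "a \<in> germ_map \<phi> -` {germ t F' | F'. F' \<in> V} \<inter> topspace germ_space"
    then obtain s F F' where a: "a = germ s F" and F: "F \<in> filters" "star s * s \<in> F"
      and F': "F' \<in> V" "germ (\<phi> s) (filter_map \<phi> F) = germ t F'"
      using germ_map_germ[OF h] by (auto simp: topspace_germ_space)
    have "filter_map \<phi> F \<in> basic_open (star (\<phi> s) * \<phi> s)" "F' \<in> basic_open (star t * t)"
      using filter_map_filter[OF h F(1)] hom_domain_mem[OF h F] F' V by (auto simp: basic_open_def)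
    from F'(2)[unfolded germ_eq_iff[OF this]]
    have r: "((\<phi> s, filter_map \<phi> F), (t, F')) \<in> germ_rel" .
    obtain u where u: "nat_le u (\<phi> s)" "nat_le u t" "star u * u \<in> filter_map \<phi> F"
      using germ_relD(5)[OF r] by auto
    \<comment> \<open>Filters at which the germ of \<open>s\<close> exists, whose image lies in
      \<open>V\<close>, and at which the same \<open>u\<close> still identifies the germs of
      \<open>\<phi> s\<close> and \<open>t\<close>.\<close>
    define W where "W = basic_open (star s * s) \<inter>
      {F \<in> topspace filter_space. filter_map \<phi> F \<in> V \<inter> basic_open (star u * u)}"
    have W: "openin filter_space W"
      unfolding W_def
      by (intro openin_Int openin_basic_open openin_continuous_map_preimage[OF c] V) auto
    let ?T = "{germ s F | F. F \<in> W}"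
    have T: "openin germ_space ?T"
      by (rule openin_germ_space[OF W]) (auto simp: W_def)
    have "F \<in> W"
      using F F' u germ_relD(1)[OF r] filter_map_filter[OF h] by (auto simp: W_def basic_open_def)
    then have "a \<in> ?T"
      using a by blast
    moreover have "germ_map \<phi> (germ s F1) \<in> {germ t F' | F'. F' \<in> V}" if F1: "F1 \<in> W" for F1
    proof -
      have "germ_map \<phi> (germ s F1) = germ (\<phi> s) (filter_map \<phi> F1)"
        using F1 by (intro germ_map_germ h) (auto simp: W_def basic_open_def)
      also have "\<dots> = germ t (filter_map \<phi> F1)"
        using F1 u by (intro germ_eqI[of _ u]) (auto simp: W_def basic_open_def)
      finally show ?thesis
        using F1 by (auto simp: W_def)
    qed
    then have "?T \<subseteq> germ_map \<phi> -` {germ t F' | F'. F' \<in> V}"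
      by blast
    ultimately show "\<exists>T. openin germ_space T \<and> a \<in> T \<and>
        T \<subseteq> germ_map \<phi> -` {germ t F' | F'. F' \<in> V} \<inter> topspace germ_space"
      using T openin_subset[OF T] by (intro exI[of _ ?T]) simp
  qed
  have 2: "germ_map \<phi> a \<in> topspace germ_space" if a: "a \<in> topspace germ_space" for a
  proof -
    obtain s F where "a = germ s F" "F \<in> filters" "star s * s \<in> F"
      using a[unfolded topspace_germ_space] by blast
    then have "germ_map \<phi> a = germ (\<phi> s) (filter_map \<phi> F)"
      "filter_map \<phi> F \<in> filters" "star (\<phi> s) * \<phi> s \<in> filter_map \<phi> F"
      using germ_map_germ[OF h] filter_map_filter[OF h] hom_domain_mem[OF h] by simp_all
    then show ?thesis
      unfolding topspace_germ_space by blast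
  qed
  show ?thesis
    \<comment> \<open>Only the codomain is unfolded to its generating sets, whose preimages are then
      tested.\<close>
    unfolding germ_space_def[where 'a = 'b]
  proof (rule continuous_on_generated_topo)
    fix U :: "('b \<times> 'b set) set set"
    assume "U \<in> {{germ s F | F. F \<in> U} | s U. openin filter_space U \<and> U \<subseteq> basic_open (star s * s)}"
    then obtain t V where "U = {germ t F' | F'. F' \<in> V}"
      "openin filter_space V" "V \<subseteq> basic_open (star t * t)"
      by blast
    then show "openin germ_space (germ_map \<phi> -` U \<inter> topspace germ_space)"
      using 1 by simp
  next
    show "germ_map \<phi> ` topspace germ_space
        \<subseteq> \<Union> {{germ s F | F. F \<in> U} | s U. openin filter_space U \<and> U \<subseteq> basic_open (star s * s)}"
      unfolding topology_generated_by_topspace[symmetric] germ_space_def[symmetric]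
      using 2 by (rule image_subsetI)
  qed
qed

section \<open>Assembly of the functor\<close>

theorem theorem6p8:
  fixes \<phi> :: "'a::inverse_semigroup \<Rightarrow> 'b::inverse_semigroup"
  assumes "semigroup_hom \<phi>"
    and "locally_coherent idempotents nat_le idempotents nat_le \<phi>"
  shows "\<exists>\<Phi>\<^sub>0 \<Phi>. continuous_functor (universal_groupoid TYPE('a)) (universal_groupoid TYPE('b)) \<Phi>\<^sub>0 \<Phi> \<and>
           (\<forall>s. \<forall>F \<in> filters. star s * s \<in> F \<longrightarrow> \<Phi> (germ s F) = germ (\<phi> s) (filter_map \<phi> F))"
proof (intro exI conjI)
  let ?G = "universal_groupoid TYPE('a)" and ?H = "universal_groupoid TYPE('b)"
  note h = assms(1)
  note germ_map = germ_map_germ[OF h] and fm = filter_map_filter[OF h] hom_domain_mem[OF h]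
  have spaces: "obj_space ?G = filter_space" "obj_space ?H = filter_space"
    "arr_space ?G = germ_space" "arr_space ?H = germ_space"
    by (simp_all add: universal_groupoid_def)
  have c: "continuous_map filter_space filter_space (filter_map \<phi>)"
    by (rule continuous_map_filter_map[OF assms])
  \<comment> \<open>Composable pairs in normal form: the left germ is based at the target
    \<open>act s F\<close> of the right one.\<close>
  have comp: "germ_map \<phi> (gcomp ?G (germ t (act s F)) (germ s F)) =
      gcomp ?H (germ_map \<phi> (germ t (act s F))) (germ_map \<phi> (germ s F))"
    if F: "F \<in> filters" "star s * s \<in> F" and t: "star t * t \<in> act s F" for s t F
  proof -
    have ts: "star (t * s) * (t * s) \<in> F"
      using t by (simp add: act_def star_mult mult.assoc)
    have "star (\<phi> t) * \<phi> t \<in> act (\<phi> s) (filter_map \<phi> F)"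
      using fm(2)[OF act_filter[OF F] t] filter_map_act[OF h F] by simp
    then show ?thesis
      by (simp add: gcomp_germ F t ts germ_map act_filter filter_map_act[OF h] fm hom_mult[OF h])
  qed
  show "continuous_functor ?G ?H (filter_map \<phi>) (germ_map \<phi>)"
    unfolding continuous_functor_def spaces
  proof (intro conjI ballI impI)
    fix a assume "a \<in> topspace (germ_space :: ('a \<times> 'a set) set topology)"
    then obtain s F where a: "a = germ s F" and F: "F \<in> filters" "star s * s \<in> F"
      by (auto simp: topspace_germ_space)
    show "src ?H (germ_map \<phi> a) = filter_map \<phi> (src ?G a)"
      using F by (simp add: a germ_map src_germ fm)
    show "tgt ?H (germ_map \<phi> a) = filter_map \<phi> (tgt ?G a)"
      using F by (simp add: a germ_map tgt_germ fm filter_map_act[OF h])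
    have "s * star s \<in> act s F"
      using F by (simp add: act_def mult.assoc)
    then show "germ_map \<phi> (ginv ?G a) = ginv ?H (germ_map \<phi> a)"
      using F by (simp add: a germ_map ginv_germ fm filter_map_act[OF h] act_filter hom_star[OF h])
  next
    fix F :: "'a set" assume "F \<in> topspace filter_space"
    then have F: "F \<in> filters"
      by simp
    then obtain e where e: "e \<in> F" "e \<in> idempotents"
      using filter_nonempty filter_idem by blast
    \<comment> \<open>The unit at \<open>F\<close> is represented by \<open>e\<close>, and the unit
      at its image by \<open>\<phi> e\<close>, which lies in
      \<open>filter_map \<phi> F\<close>.\<close>
    have "star e * e \<in> F"
      using e by (simp add: star_idem idem_mult)
    then show "germ_map \<phi> (unit_arr ?G F) = unit_arr ?H (filter_map \<phi> F)"
      by (simp add: unit_germ[OF F e(1)] germ_map F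
          unit_germ[OF fm(1)[OF F] mem_filter_mapI[OF h F e(1)]])
  next
    fix a b :: "('a \<times> 'a set) set"
    \<comment> \<open>Equality of source and target forces \<open>F' = act s F\<close>, which is the
      normal form of \<open>comp\<close>.\<close>
    assume ab: "a \<in> topspace germ_space" "b \<in> topspace germ_space" "src ?G a = tgt ?G b"
    then obtain t F' s F where "a = germ t F'" "F' \<in> filters" "star t * t \<in> F'"
      and "b = germ s F" "F \<in> filters" "star s * s \<in> F"
      by (auto simp: topspace_germ_space)
    then show "germ_map \<phi> (gcomp ?G a b) = gcomp ?H (germ_map \<phi> a) (germ_map \<phi> b)"
      using comp ab(3) by (simp add: src_germ tgt_germ)
  qed (use c continuous_map_germ_map[OF h c] in auto)
  show "\<forall>s. \<forall>F \<in> filters. star s * s \<in> F \<longrightarrow> germ_map \<phi> (germ s F) = germ (\<phi> s) (filter_map \<phi> F)"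
    using germ_map by blast
qed

end
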